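(* Let $0<s<1$ and $\kappa>2$. Let $W(\mathbf{x})=|\mathbf{x}|^{-s}\Omega(\theta)+|\mathbf{x}|^2$ on $\mathbb{R}^2$, where $\Omega:S^1\to\mathbb{R}$ is smooth, strictly positive, $\Omega(\theta+\pi)=\Omega(\theta)$, $\Omega(\frac{\pi}{2})=1$, and $$\Omega(\theta)\le 1+C\big|\theta-\tfrac{\pi}{2}\big|^{\kappa}$$ for some constant $C$ and any $\theta$ near $\frac{\pi}{2}$. Then $\rho_{\mathrm{1D}}$ is not a $d_\infty$-local minimizer of the energy associated to $W$. In particular, let $\omega:S^1\to\mathbb{R}$ be smooth, nonnegative, not identically zero, with $\omega(\theta+\pi)=\omega(\theta)$, $\omega(\frac{\pi}{2})=0$ and $\omega(\theta)\le C|\theta-\frac{\pi}{2}|^{\kappa}$ for $\theta$ near $\frac{\pi}{2}$. Then, for any $\alpha>0$, $\rho_{\mathrm{1D}}$ is not a $d_\infty$-local minimizer of the energy $E_\alpha$ associated to $W_\alpha(\mathbf{x})=|\mathbf{x}|^{-s}(1+\alpha\omega(\theta))+|\mathbf{x}|^2$.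
   Context: $S^1=[-\pi,\pi)$ is the set of angles (mod $2\pi$); $\theta$ is the angle of $\mathbf{x}\in\mathbb{R}^2\setminus\{0\}$, i.e. $\mathbf{x}/|\mathbf{x}|=(\cos\theta,\sin\theta)$. For an interaction potential $W$, its associated energy is $E[\rho]=\frac12\int_{\mathbb{R}^2}\int_{\mathbb{R}^2}W(\mathbf{x}-\mathbf{y})\rho(\mathbf{y})\,\mathrm{d}\mathbf{y}\,\rho(\mathbf{x})\,\mathrm{d}\mathbf{x}$ for probability measures $\rho$ on $\mathbb{R}^2$. $d_\infty$ is the Wasserstein-infinity distance; $\rho$ is a $d_\infty$-local minimizer of $E$ if there is $\epsilon>0$ such that $E[\rho]\le E[\rho']$ for every probability measure $\rho'$ with $d_\infty(\rho,\rho')<\epsilon$. $\rho_{\mathrm{1D}}(\mathbf{x})=\rho_1(x_2)\delta(x_1)$, where $\rho_1(x)=C_1(R_1^2-|x|^2)_+^{(1+s)/2}$, $R_1=\Big(\frac{2\cos\frac{s\pi}{2}}{s(s+1)\pi}\beta\big(\frac12,\frac{3+s}{2}\big)\Big)^{-\frac{1}{s+2}}$, $C_1=\frac{2\cos\frac{s\pi}{2}}{s(s+1)\pi}$ ($\beta$ is the Beta function). *)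

theory Defs
  imports "HOL-Probability.Probability"
begin

text \<open>Smooth functions on the circle are represented by their lifts: smooth functions on the
  real line of period \<open>2 * pi\<close>.\<close>

definition smooth_on_circle :: "(real \<Rightarrow> real) \<Rightarrow> bool" where
  "smooth_on_circle f \<longleftrightarrow>
     (\<forall>\<theta>. f (\<theta> + 2 * pi) = f \<theta>) \<and> (\<forall>k. (deriv ^^ k) f differentiable_on UNIV)"

definition polar_angle :: "real^2 \<Rightarrow> real" where
  "polar_angle x =
     (THE \<theta>. - pi \<le> \<theta> \<and> \<theta> < pi \<and> x /\<^sub>R norm x = vector [cos \<theta>, sin \<theta>])"

lemma polar_angle_spec:
  assumes "x \<noteq> 0"
  shows "- pi \<le> polar_angle x \<and> polar_angle x < pi \<and>
    x /\<^sub>R norm x = vector [cos (polar_angle x), sin (polar_angle x)]"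
proof -
  define u where "u = x /\<^sub>R norm x"
  have "norm u = 1" using assms by (simp add: u_def)
  then have c: "(u $ 1)\<^sup>2 + (u $ 2)\<^sup>2 = 1"
    by (simp add: norm_vec_def L2_set_def UNIV_2)
  obtain t where t: "0 \<le> t" "t < 2 * pi" "u $ 1 = cos t" "u $ 2 = sin t"
    using sincos_total_2pi[OF c] by metis
  have v: "u = vector [cos y, sin y] \<longleftrightarrow> cos y = cos t \<and> sin y = sin t" for y
    using t by (auto simp: vec_eq_iff forall_2)
  show ?thesis unfolding polar_angle_def u_def[symmetric]
  proof (rule theI')
    show "\<exists>!y. - pi \<le> y \<and> y < pi \<and> u = vector [cos y, sin y]"
      unfolding v
    proof (rule ex_ex1I)
      show "\<exists>y. - pi \<le> y \<and> y < pi \<and> cos y = cos t \<and> sin y = sin t"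
      proof (cases "t < pi")
        case True then show ?thesis using t by (intro exI[of _ t]) auto
      next
        case False then show ?thesis using t by (intro exI[of _ "t - 2 * pi"]) (auto simp: cos_diff sin_diff)
      qed
    next
      fix y z
      assume yz: "- pi \<le> y \<and> y < pi \<and> cos y = cos t \<and> sin y = sin t"
        "- pi \<le> z \<and> z < pi \<and> cos z = cos t \<and> sin z = sin t"
      then have "sin y = sin z \<and> cos y = cos z" by simp
      then obtain n :: int where n: "y = z + 2 * pi * n"
        using sin_cos_eq_iff[of y z] by auto
      have "(2 * pi) * real_of_int n < (2 * pi) * 1" "(2 * pi) * (- 1) < (2 * pi) * real_of_int n"
        using yz n by linarith+
      then have "real_of_int n < 1" "- 1 < real_of_int n"
        by (metis mult_less_cancel_left_pos[of "2 * pi"] pi_gt_zero zero_less_mult_iff zero_less_numeral)+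
      then have "n = 0" by linarith
      then show "y = z" using n by simp
    qed
  qed
qed

text \<open>The value at the origin is \<open>\<infinity>\<close>, the limit there of \<open>norm x powr (- s) * \<Omega> \<theta>\<close> for
  \<open>s > 0\<close>; the convention \<open>0 powr (- s) = 0\<close> would wrongly give atoms zero
  self-interaction. Meant for positive \<open>\<Omega>\<close>, since \<open>ennreal\<close> truncates negative values.\<close>

definition anisotropic_potential :: "real \<Rightarrow> (real \<Rightarrow> real) \<Rightarrow> real^2 \<Rightarrow> ennreal" where
  "anisotropic_potential s \<Omega> x =
     (if x = 0 then \<infinity>
      else ennreal (norm x powr (- s) * \<Omega> (polar_angle x) + (norm x)\<^sup>2))"

definition interaction_energy :: "(real^2 \<Rightarrow> ennreal) \<Rightarrow> (real^2) measure \<Rightarrow> ennreal" where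
  "interaction_energy W \<rho> = (1 / 2) * (\<integral>\<^sup>+ x. (\<integral>\<^sup>+ y. W (x - y) \<partial>\<rho>) \<partial>\<rho>)"

definition borel_prob_measure :: "(real^2) measure \<Rightarrow> bool" where
  "borel_prob_measure \<rho> \<longleftrightarrow> prob_space \<rho> \<and> sets \<rho> = sets borel"

definition couplings ::
    "(real^2) measure \<Rightarrow> (real^2) measure \<Rightarrow> ((real^2) \<times> (real^2)) measure set" where
  "couplings \<mu> \<nu> =
     {\<gamma>. prob_space \<gamma> \<and> sets \<gamma> = sets borel \<and>
          distr \<gamma> borel fst = \<mu> \<and> distr \<gamma> borel snd = \<nu>}"

definition wasserstein_inf :: "(real^2) measure \<Rightarrow> (real^2) measure \<Rightarrow> ennreal" where
  "wasserstein_inf \<mu> \<nu> =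
     (INF \<gamma> \<in> couplings \<mu> \<nu>. esssup \<gamma> (\<lambda>(x, y). ennreal (dist x y)))"

definition winf_local_minimizer ::
    "((real^2) measure \<Rightarrow> ennreal) \<Rightarrow> (real^2) measure \<Rightarrow> bool" where
  "winf_local_minimizer E \<rho> \<longleftrightarrow>
     (\<exists>\<epsilon>>0. \<forall>\<rho>'. borel_prob_measure \<rho>' \<and> wasserstein_inf \<rho> \<rho>' < ennreal \<epsilon> \<longrightarrow> E \<rho> \<le> E \<rho>')"

definition C1 :: "real \<Rightarrow> real" where
  "C1 s = 2 * cos (s * pi / 2) / (s * (s + 1) * pi)"

definition R1 :: "real \<Rightarrow> real" where
  "R1 s = (2 * cos (s * pi / 2) / (s * (s + 1) * pi) * Beta (1 / 2) ((3 + s) / 2))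
            powr (- (1 / (s + 2)))"

definition rho1 :: "real \<Rightarrow> real \<Rightarrow> real" where
  "rho1 s x = C1 s * (max 0 ((R1 s)\<^sup>2 - \<bar>x\<bar>\<^sup>2)) powr ((1 + s) / 2)"

text \<open>The measure \<open>\<rho>\<^sub>1(x\<^sub>2) \<delta>(x\<^sub>1)\<close>, as the push-forward of \<open>\<rho>\<^sub>1\<close> to the vertical axis.\<close>

definition rho_1D :: "real \<Rightarrow> (real^2) measure" where
  "rho_1D s = distr (density lborel (\<lambda>t. ennreal (rho1 s t))) borel (\<lambda>t. vector [0, t])"

end

theory Submission
  imports Defs
begin

text \<open>
  The vertical line can be bent slightly so that the energy decreases. Move the point \<open>(0, t)\<close> to
  \<open>(\<epsilon> * \<phi> t, t)\<close>, where \<open>\<phi>\<close> is 1-Lipschitz. The segment between the images of \<open>t\<close> and \<open>u\<close> has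
  slope \<open>r = \<epsilon> * (\<phi> t - \<phi> u) / (t - u)\<close> against the vertical, so \<open>\<bar>r\<bar> \<le> \<epsilon>\<close> for all pairs, however close.
  Three effects change the interaction of a pair at vertical distance \<open>d = \<bar>t - u\<bar>\<close>: the longer
  distance lowers the repulsion by a multiple of \<open>d powr (- s) * r\<^sup>2\<close>; the angular factor raises it by at most a
  multiple of \<open>d powr (- s) * \<bar>r\<bar> powr \<kappa>\<close>, which is negligible because \<open>\<kappa> > 2\<close>; the quadratic confinement
  grows by \<open>\<epsilon>\<^sup>2 * (\<phi> t - \<phi> u)\<^sup>2\<close>. This is \<open>tilted_kernel_le\<close> and \<open>anisotropic_potential_tilted_le\<close>.

  Up to the factor \<open>\<epsilon>\<^sup>2\<close>, the energy gained is a fractional Sobolev seminorm of \<open>\<phi>\<close>, of order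
  \<open>(1 + s) / 2\<close>, whereas the energy lost is a squared norm of order 0. The former dominates for functions
  concentrated at a small scale. A tent of height and half-width \<open>\<eta>\<close> suffices: its gain is of order
  \<open>\<eta> powr (2 - s)\<close> and its loss of order \<open>\<eta> ^ 3\<close> (\<open>tent_lowers_energy\<close>, \<open>tent_width_exists\<close>). The competitor is
  within \<open>\<epsilon> * \<eta>\<close> of \<open>\<rho>\<close>, so it lies in any prescribed neighbourhood.

  The argument uses of \<open>\<rho>\<^sub>1\<close> that it is a probability density (\<open>nn_integral_rho1\<close>), bounded, positive near
  \<open>0\<close> and of finite energy (\<open>profile_energy_finite\<close>). Both parts of the theorem
  are instances of \<open>rho_1D_not_local_minimizer\<close>, the second with \<open>\<Omega> = 1 + \<alpha> * \<omega>\<close>.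
\<close>

section \<open>Plane vectors and periodic functions of the polar angle\<close>

lemma vector_2_eq_axes: "vector [a, b] = a *\<^sub>R axis 1 1 + b *\<^sub>R (axis 2 1 :: real^2)"
  by (simp add: vec_eq_iff forall_2 axis_def)

lemma vector_2_borel_measurable [measurable]:
  fixes f g :: "'a \<Rightarrow> real"
  assumes [measurable]: "f \<in> borel_measurable M" "g \<in> borel_measurable M"
  shows "(\<lambda>t. vector [f t, g t] :: real^2) \<in> borel_measurable M"
  unfolding vector_2_eq_axes by measurable

lemma norm_vector_2: "norm (vector [a, b] :: real^2) = sqrt (a\<^sup>2 + b\<^sup>2)"
  by (simp add: norm_vec_def L2_set_def UNIV_2)

text \<open>A function of period \<open>pi\<close> only sees the line spanned by \<open>x\<close>, and the inclination of that
  line is determined by the slope \<open>x $ 1 / x $ 2\<close> against the vertical axis. This form is Borel in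
  \<open>x\<close>, and it shows directly that \<open>\<Omega>\<close> is evaluated near \<open>pi / 2\<close> when the slope is small.\<close>

lemma periodic_polar_angle:
  fixes \<Omega> :: "real \<Rightarrow> real" and x :: "real^2"
  assumes per: "\<And>\<theta>. \<Omega> (\<theta> + pi) = \<Omega> \<theta>" and x: "x $ 2 \<noteq> 0"
  shows "\<Omega> (polar_angle x) = \<Omega> (pi / 2 - arctan (x $ 1 / x $ 2))"
proof -
  define \<theta> where "\<theta> = polar_angle x"
  define \<phi> where "\<phi> = pi / 2 - arctan (x $ 1 / x $ 2)"
  have x0: "x \<noteq> 0" using x by auto
  have "x = norm x *\<^sub>R (x /\<^sub>R norm x)" using x0 by simp
  also have "x /\<^sub>R norm x = vector [cos \<theta>, sin \<theta>]"
    using polar_angle_spec[OF x0] by (simp add: \<theta>_def)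
  finally have xv: "x = norm x *\<^sub>R vector [cos \<theta>, sin \<theta>]" .
  have x1: "x $ 1 = norm x * cos \<theta>" and x2: "x $ 2 = norm x * sin \<theta>"
    by (subst xv, simp)+
  have s0: "sin \<theta> \<noteq> 0" using x x2 by auto
  have "cos \<theta> / sin \<theta> = tan (arctan (x $ 1 / x $ 2))"
    using x0 by (simp add: x1 x2 tan_arctan)
  also have "\<dots> = cos \<phi> / sin \<phi>"
    by (simp add: \<phi>_def tan_def cos_diff sin_diff)
  finally have "cos \<theta> / sin \<theta> = cos \<phi> / sin \<phi>" .
  moreover have "sin \<phi> \<noteq> 0" by (simp add: \<phi>_def sin_diff)
  ultimately have "cos \<theta> * sin \<phi> = cos \<phi> * sin \<theta>"
    using s0 by (simp add: frac_eq_eq)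
  then have "sin (\<theta> - \<phi>) = 0" by (simp add: sin_diff)
  then obtain n :: int where n: "\<theta> - \<phi> = of_int n * pi"
    using sin_zero_iff_int2 by blast
  have shift: "\<Omega> (t + of_int k * pi) = \<Omega> t" for t k
  proof (induction k arbitrary: t rule: int_induct[where k=0])
    case (step1 i) then show ?case using per[of "t + of_int i * pi"] by (simp add: algebra_simps)
  next
    case (step2 i) then show ?case using per[of "t + of_int (i - 1) * pi"] by (simp add: algebra_simps)
  qed simp
  have "\<theta> = \<phi> + of_int n * pi" using n by simp
  then have "\<Omega> \<theta> = \<Omega> \<phi>" using shift by simp
  then show ?thesis by (simp only: \<theta>_def \<phi>_def)
qed

lemma polar_angle_horizontal:
  fixes \<Omega> :: "real \<Rightarrow> real" and x :: "real^2"
  assumes per: "\<And>\<theta>. \<Omega> (\<theta> + pi) = \<Omega> \<theta>" and x: "x $ 2 = 0" "x \<noteq> 0"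
  shows "\<Omega> (polar_angle x) = \<Omega> 0"
proof -
  note sp = polar_angle_spec[OF x(2)]
  have "x /\<^sub>R norm x = vector [cos (polar_angle x), sin (polar_angle x)]" using sp by blast
  then have "(x /\<^sub>R norm x) $ 2 = sin (polar_angle x)" by simp
  then have "sin (polar_angle x) = 0" using x by simp
  then consider "polar_angle x = 0" | "polar_angle x = -pi"
    using sp sin_gt_zero[of "polar_angle x"] sin_gt_zero[of "- polar_angle x"] by force
  then show ?thesis using per[of "-pi"] by cases auto
qed

lemma anisotropic_potential_measurable [measurable]:
  fixes \<Omega> :: "real \<Rightarrow> real"
  assumes per: "\<And>\<theta>. \<Omega> (\<theta> + pi) = \<Omega> \<theta>" and cont: "continuous_on UNIV \<Omega>"
  shows "anisotropic_potential s \<Omega> \<in> borel_measurable borel"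
proof -
  have [measurable]: "\<Omega> \<in> borel_measurable borel"
    using cont by (rule borel_measurable_continuous_onI)
  have [measurable]: "arctan \<in> borel_measurable borel"
    by (intro borel_measurable_continuous_onI continuous_intros)
  have [measurable]: "(\<lambda>x::real^2. x $ i) \<in> borel_measurable borel" for i
    by (intro borel_measurable_continuous_onI continuous_intros)
  have "anisotropic_potential s \<Omega> = (\<lambda>x. if x = 0 then \<infinity> else ennreal (norm x powr (- s) *
      (if x $ 2 = 0 then \<Omega> 0 else \<Omega> (pi / 2 - arctan (x $ 1 / x $ 2))) + (norm x)\<^sup>2))"
    using periodic_polar_angle[of \<Omega>] polar_angle_horizontal[of \<Omega>] per
    by (auto simp: anisotropic_potential_def fun_eq_iff)
  then show ?thesis by simp
qed

section \<open>The interaction along a tilted direction\<close>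

text \<open>Tilting a vertical segment to slope \<open>r\<close>, keeping its vertical extent, lengthens it by the factor
  \<open>sqrt (1 + r\<^sup>2)\<close>, which decreases the repulsion by an amount of order \<open>s * r\<^sup>2\<close>. The anisotropy
  costs at most \<open>C * \<bar>r\<bar> powr \<kappa>\<close>, of smaller order since \<open>\<kappa> > 2\<close>. The constant \<open>s / 16\<close> is what
  remains of the elementary bound \<open>s / 8\<close> after half of it has paid for the anisotropy.\<close>

lemma tilted_kernel_le:
  fixes \<Omega> :: "real \<Rightarrow> real"
  assumes s: "0 < s" "s < 1" and k: "\<kappa> > 2"
    and bound: "\<forall>\<^sub>F \<theta> in nhds (pi / 2). \<Omega> \<theta> \<le> 1 + C * \<bar>\<theta> - pi / 2\<bar> powr \<kappa>"
  shows "\<exists>r0>0. r0 \<le> 1 \<and> (\<forall>r. \<bar>r\<bar> \<le> r0 \<longrightarrow>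
    (1 + r\<^sup>2) powr (- s / 2) * \<Omega> (pi / 2 - arctan r) \<le> 1 - s / 16 * r\<^sup>2)"
proof -
  define D where "D = max C 1"
  obtain d where d: "d > 0" "\<And>\<theta>. dist \<theta> (pi / 2) < d \<Longrightarrow> \<Omega> \<theta> \<le> 1 + C * \<bar>\<theta> - pi / 2\<bar> powr \<kappa>"
    using bound unfolding eventually_nhds_metric by blast
  \<comment> \<open>The last bound makes \<open>D * \<bar>r\<bar> powr \<kappa> \<le> s / 16 * r\<^sup>2\<close>; \<open>d\<close> keeps the angle in the range of \<open>bound\<close>.\<close>
  define r0 where "r0 = min (min 1 (d / 2)) ((s / (16 * D)) powr (1 / (\<kappa> - 2)))"
  have D: "D \<ge> 1" "C \<le> D" by (auto simp: D_def)
  have r0: "r0 > 0" using d s D by (auto simp: r0_def)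
  have r01: "r0 \<le> 1" by (simp add: r0_def)
  show ?thesis
  proof (intro exI[of _ r0] conjI allI impI r0 r01)
    fix r :: real assume r: "\<bar>r\<bar> \<le> r0"
    have r1: "\<bar>r\<bar> \<le> 1" "\<bar>r\<bar> < d" "\<bar>r\<bar> \<le> (s / (16 * D)) powr (1 / (\<kappa> - 2))"
      using r d by (auto simp: r0_def)
    have at: "\<bar>arctan r\<bar> \<le> \<bar>r\<bar>"
      by (rule abs_arctan_le)
    have rk: "D * \<bar>r\<bar> powr \<kappa> \<le> s / 16 * r\<^sup>2"
    proof (cases "r = 0")
      case False
      have "\<bar>r\<bar> powr (\<kappa> - 2) \<le> ((s / (16 * D)) powr (1 / (\<kappa> - 2))) powr (\<kappa> - 2)"
        using r1 k by (intro powr_mono2) auto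
      also have "\<dots> = s / (16 * D)" using k s D by (simp add: powr_powr)
      finally have "\<bar>r\<bar> powr (\<kappa> - 2) \<le> s / (16 * D)" .
      moreover have "\<bar>r\<bar> powr \<kappa> = \<bar>r\<bar> powr (\<kappa> - 2) * r\<^sup>2"
        using False by (simp add: powr_diff)
      moreover have "D * \<bar>r\<bar> powr (\<kappa> - 2) * r\<^sup>2 \<le> s / 16 * r\<^sup>2"
        using calculation(1) D by (intro mult_right_mono) (auto simp: field_simps)
      ultimately show ?thesis by (simp add: mult.assoc)
    qed simp
    have "\<Omega> (pi / 2 - arctan r) \<le> 1 + C * \<bar>arctan r\<bar> powr \<kappa>"
      using d(2)[of "pi / 2 - arctan r"] at r1 by (simp add: dist_real_def)
    also have "\<dots> \<le> 1 + D * \<bar>r\<bar> powr \<kappa>"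
      using at D k by (intro add_mono mult_mono powr_mono2) auto
    finally have O: "\<Omega> (pi / 2 - arctan r) \<le> 1 + D * \<bar>r\<bar> powr \<kappa>" .
    have rr: "r\<^sup>2 \<le> 1" using r1 by (simp add: abs_square_le_1)
    have "- ln (1 + r\<^sup>2) = ln (1 / (1 + r\<^sup>2))" by (simp add: ln_div add_nonneg_eq_0_iff)
    also have "\<dots> \<le> 1 / (1 + r\<^sup>2) - 1"
      by (intro ln_le_minus_one) (auto intro: add_pos_nonneg)
    also have "\<dots> \<le> - r\<^sup>2 / 2"
    proof -
      have "1 \<le> (1 - r\<^sup>2 / 2) * (1 + r\<^sup>2)"
        using rr mult_right_mono[OF rr, of "r\<^sup>2"] by (simp add: algebra_simps)
      then have "1 / (1 + r\<^sup>2) \<le> 1 - r\<^sup>2 / 2"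
        by (subst pos_divide_le_eq) (auto intro: add_pos_nonneg)
      then show ?thesis by simp
    qed
    finally have ln: "r\<^sup>2 / 2 \<le> ln (1 + r\<^sup>2)" by simp
    define y where "y = s * r\<^sup>2 / 4"
    have y: "0 \<le> y" "y \<le> 1" using s rr mult_mono[of s 1 "r\<^sup>2" 1] by (auto simp: y_def)
    have "(1 + r\<^sup>2) powr (- s / 2) = exp (- (s / 2 * ln (1 + r\<^sup>2)))"
      by (simp add: powr_def add_nonneg_eq_0_iff)
    also have "\<dots> \<le> exp (- y)"
      using mult_left_mono[OF ln, of "s / 2"] s by (simp add: y_def)
    also have "\<dots> \<le> 1 / (1 + y)"
      using exp_ge_add_one_self[of y] y by (simp add: exp_minus field_simps)
    also have "\<dots> \<le> 1 - y / 2"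
      using y mult_left_mono[of y 1 y] by (simp add: field_simps)
    finally have P: "(1 + r\<^sup>2) powr (- s / 2) \<le> 1 - s / 8 * r\<^sup>2" by (simp add: y_def)
    have P1: "1 - s / 8 * r\<^sup>2 \<le> 1" using s by simp
    have "(1 + r\<^sup>2) powr (- s / 2) * \<Omega> (pi / 2 - arctan r)
        \<le> (1 + r\<^sup>2) powr (- s / 2) * (1 + D * \<bar>r\<bar> powr \<kappa>)"
      using O by (intro mult_left_mono) auto
    also have "\<dots> = (1 + r\<^sup>2) powr (- s / 2) + (1 + r\<^sup>2) powr (- s / 2) * (D * \<bar>r\<bar> powr \<kappa>)"
      by (simp add: distrib_left)
    also have "\<dots> \<le> (1 - s / 8 * r\<^sup>2) + 1 * (D * \<bar>r\<bar> powr \<kappa>)"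
      using P P1 D by (intro add_mono mult_right_mono order.trans[OF P P1]) auto
    finally show "(1 + r\<^sup>2) powr (- s / 2) * \<Omega> (pi / 2 - arctan r) \<le> 1 - s / 16 * r\<^sup>2"
      using rk by simp
  qed
qed

section \<open>Measures on graphs over the vertical axis\<close>

text \<open>All measures whose energies are compared have this form; with \<open>\<mu>\<close> the profile and \<open>f = 0\<close> it is \<open>rho_1D\<close>.\<close>

definition graph_measure :: "real measure \<Rightarrow> (real \<Rightarrow> real) \<Rightarrow> (real^2) measure" where
  "graph_measure \<mu> f = distr \<mu> borel (\<lambda>t. vector [f t, t])"

lemma vector_2_diff: "vector [a, b] - vector [c, d] = (vector [a - c, b - d] :: real^2)"
  by (simp add: vec_eq_iff forall_2)

lemma borel_prob_measure_graph:
  assumes "prob_space \<mu>" and [measurable_cong]: "sets \<mu> = sets borel"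
    and [measurable]: "f \<in> borel_measurable borel"
  shows "borel_prob_measure (graph_measure \<mu> f)"
  unfolding borel_prob_measure_def graph_measure_def
  by (auto intro!: prob_space.prob_space_distr assms(1))

lemma interaction_energy_graph:
  assumes "prob_space \<mu>" and [measurable_cong]: "sets \<mu> = sets borel"
    and [measurable]: "f \<in> borel_measurable borel" "W \<in> borel_measurable borel"
  shows "interaction_energy W (graph_measure \<mu> f) =
    (1 / 2) * (\<integral>\<^sup>+ t. (\<integral>\<^sup>+ u. W (vector [f t - f u, t - u]) \<partial>\<mu>) \<partial>\<mu>)"
proof -
  interpret prob_space \<mu> by fact
  have "(\<integral>\<^sup>+ y. W (x - y) \<partial>graph_measure \<mu> f) = (\<integral>\<^sup>+ u. W (x - vector [f u, u]) \<partial>\<mu>)" for x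
    unfolding graph_measure_def by (subst nn_integral_distr) auto
  then show ?thesis
    unfolding interaction_energy_def
    by (subst graph_measure_def) (simp add: nn_integral_distr vector_2_diff)
qed

text \<open>Transport is horizontal: \<open>(0, t)\<close> is sent to \<open>(f t, t)\<close>.\<close>

lemma wasserstein_inf_graph_le:
  assumes "prob_space \<mu>" and [measurable_cong]: "sets \<mu> = sets borel"
    and [measurable]: "f \<in> borel_measurable borel"
    and \<delta>: "\<And>t. \<bar>f t\<bar> \<le> \<delta>"
  shows "wasserstein_inf (graph_measure \<mu> (\<lambda>_. 0)) (graph_measure \<mu> f) \<le> ennreal \<delta>"
proof -
  interpret prob_space \<mu> by fact
  define \<gamma> :: "((real^2) \<times> (real^2)) measure"
    where "\<gamma> = distr \<mu> borel (\<lambda>t. (vector [0, t], vector [f t, t]))"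
  have [measurable]: "(\<lambda>t. (vector [0, t] :: real^2, vector [f t, t] :: real^2)) \<in> \<mu> \<rightarrow>\<^sub>M borel"
    by (simp add: borel_prod[symmetric])
  have [measurable]: "fst \<in> borel \<rightarrow>\<^sub>M (borel :: (real^2) measure)"
     "snd \<in> borel \<rightarrow>\<^sub>M (borel :: (real^2) measure)"
    by (intro borel_measurable_continuous_onI continuous_intros)+
  have "prob_space \<gamma>" unfolding \<gamma>_def by (rule prob_space_distr) simp
  then have "\<gamma> \<in> couplings (graph_measure \<mu> (\<lambda>_. 0)) (graph_measure \<mu> f)"
    by (simp add: couplings_def graph_measure_def \<gamma>_def distr_distr o_def)
  moreover have "esssup \<gamma> (\<lambda>(x, y). ennreal (dist x y)) \<le> ennreal \<delta>"
  proof (rule esssup_I)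
    show m: "(\<lambda>(x, y). ennreal (dist x y)) \<in> borel_measurable \<gamma>"
      by (simp add: \<gamma>_def borel_prod[symmetric] split_beta')
    have "dist (vector [0, t]) (vector [f t, t] :: real^2) \<le> \<delta>" for t
      using \<delta>[of t] by (simp add: dist_norm vector_2_diff norm_vector_2)
    then show "AE z in \<gamma>. (case z of (x, y) \<Rightarrow> ennreal (dist x y)) \<le> ennreal \<delta>"
      unfolding \<gamma>_def using m
      by (subst AE_distr_iff) (auto simp: \<gamma>_def intro!: ennreal_leI)
  qed
  ultimately show ?thesis
    unfolding wasserstein_inf_def by (rule INF_lower2)
qed

section \<open>Energy of a bent measure\<close>

lemma anisotropic_potential_vertical:
  fixes \<Omega> :: "real \<Rightarrow> real"
  assumes per: "\<And>\<theta>. \<Omega> (\<theta> + pi) = \<Omega> \<theta>" and one: "\<Omega> (pi / 2) = 1" and "b \<noteq> 0"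
  shows "anisotropic_potential s \<Omega> (vector [0, b]) = ennreal (\<bar>b\<bar> powr (- s) + b\<^sup>2)"
proof -
  have "(vector [0, b] :: real^2) \<noteq> 0" using assms(3) by (auto simp: vec_eq_iff forall_2)
  then show ?thesis
    using periodic_polar_angle[of \<Omega> "vector [0, b]"] assms
    by (simp add: anisotropic_potential_def norm_vector_2)
qed

text \<open>The gain is put on the left so that both sides stay nonnegative: the inequality can then be integrated
  in \<open>ennreal\<close>, where subtraction is truncated. The first term on the right is the potential of
  the straight pair; the second is the cost of the horizontal displacement in the confining
  term.\<close>

lemma anisotropic_potential_tilted_le:
  fixes \<Omega> :: "real \<Rightarrow> real"
  assumes per: "\<And>\<theta>. \<Omega> (\<theta> + pi) = \<Omega> \<theta>"
    and s: "0 < s" "s < 1"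
    and gain: "\<And>r. \<bar>r\<bar> \<le> r0 \<Longrightarrow>
      (1 + r\<^sup>2) powr (- s / 2) * \<Omega> (pi / 2 - arctan r) \<le> 1 - s / 16 * r\<^sup>2"
    and \<epsilon>: "0 < \<epsilon>" "\<epsilon> \<le> r0" "r0 \<le> 1" and ab: "b \<noteq> 0" "\<bar>a\<bar> \<le> \<bar>b\<bar>"
  shows "anisotropic_potential s \<Omega> (vector [\<epsilon> * a, b]) +
      ennreal (s / 16 * \<epsilon>\<^sup>2 * (a\<^sup>2 * \<bar>b\<bar> powr (- s - 2)))
    \<le> ennreal (\<bar>b\<bar> powr (- s) + b\<^sup>2) + ennreal (\<epsilon>\<^sup>2 * a\<^sup>2)"
proof -
  define r where "r = \<epsilon> * a / b"
  define x :: "real^2" where "x = vector [\<epsilon> * a, b]"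
  have x0: "x \<noteq> 0" using ab by (auto simp: x_def vec_eq_iff forall_2)
  have r: "\<bar>r\<bar> \<le> r0" "\<bar>r\<bar> \<le> 1"
  proof -
    have "\<bar>r\<bar> = \<epsilon> * (\<bar>a\<bar> / \<bar>b\<bar>)" using \<epsilon> by (simp add: r_def abs_mult)
    also have "\<dots> \<le> \<epsilon> * 1" using ab \<epsilon> by (intro mult_left_mono) auto
    finally show "\<bar>r\<bar> \<le> r0" "\<bar>r\<bar> \<le> 1" using \<epsilon> by auto
  qed
  have n2: "(norm x)\<^sup>2 = b\<^sup>2 + \<epsilon>\<^sup>2 * a\<^sup>2"
    by (simp add: x_def norm_vector_2 power_mult_distrib)
  have "norm x = sqrt (b\<^sup>2 * (1 + r\<^sup>2))"
    using ab by (simp add: x_def norm_vector_2 r_def field_simps power_divide)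
  also have "\<dots> = \<bar>b\<bar> * (1 + r\<^sup>2) powr (1 / 2)"
    by (simp add: real_sqrt_mult powr_half_sqrt)
  finally have n: "norm x powr (- s) = \<bar>b\<bar> powr (- s) * (1 + r\<^sup>2) powr (- s / 2)"
    by (simp add: powr_mult powr_powr)
  have r2: "s / 16 * r\<^sup>2 \<le> 1"
    using s r mult_mono[of s 1 "r\<^sup>2" 1] by (auto simp: abs_square_le_1)
  have br: "\<bar>b\<bar> powr (- s) * r\<^sup>2 = \<epsilon>\<^sup>2 * (a\<^sup>2 * \<bar>b\<bar> powr (- s - 2))"
    using ab by (simp add: r_def powr_diff power_divide power_mult_distrib)
  have "norm x powr (- s) * \<Omega> (polar_angle x) =
      \<bar>b\<bar> powr (- s) * ((1 + r\<^sup>2) powr (- s / 2) * \<Omega> (pi / 2 - arctan r))"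
    using periodic_polar_angle[of \<Omega> x] per ab by (simp add: n[unfolded x_def r_def] r_def x_def)
  also have "\<dots> \<le> \<bar>b\<bar> powr (- s) * (1 - s / 16 * r\<^sup>2)"
    using gain[OF r(1)] by (intro mult_left_mono) auto
  finally have *: "anisotropic_potential s \<Omega> x
      \<le> ennreal (\<bar>b\<bar> powr (- s) * (1 - s / 16 * r\<^sup>2) + (b\<^sup>2 + \<epsilon>\<^sup>2 * a\<^sup>2))"
    using x0 by (simp add: anisotropic_potential_def n2 ennreal_leI)
  have nn: "0 \<le> \<bar>b\<bar> powr (- s) * (1 - s / 16 * r\<^sup>2) + (b\<^sup>2 + \<epsilon>\<^sup>2 * a\<^sup>2)"
    using r2 by (intro add_nonneg_nonneg mult_nonneg_nonneg) auto
  from * have "anisotropic_potential s \<Omega> x + ennreal (s / 16 * (\<bar>b\<bar> powr (- s) * r\<^sup>2))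
      \<le> ennreal (\<bar>b\<bar> powr (- s) * (1 - s / 16 * r\<^sup>2) + (b\<^sup>2 + \<epsilon>\<^sup>2 * a\<^sup>2))
        + ennreal (s / 16 * (\<bar>b\<bar> powr (- s) * r\<^sup>2))"
    by (rule add_right_mono)
  also have "\<dots> = ennreal (\<bar>b\<bar> powr (- s) + b\<^sup>2 + \<epsilon>\<^sup>2 * a\<^sup>2)"
    using s by (subst ennreal_plus[symmetric, OF nn]) (auto simp: algebra_simps)
  also have "\<dots> = ennreal (\<bar>b\<bar> powr (- s) + b\<^sup>2) + ennreal (\<epsilon>\<^sup>2 * a\<^sup>2)"
    by (subst ennreal_plus[symmetric]) auto
  finally show ?thesis unfolding br x_def by (simp only: mult.assoc)
qed

text \<open>The tent has slope \<open>-1\<close> on \<open>{0..\<eta>}\<close>, so pairs in this interval at vertical distance \<open>d\<close> each gain at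
  least \<open>s / 16 * \<epsilon>\<^sup>2 * d powr (- s) \<ge> s / 16 * \<epsilon>\<^sup>2 * \<eta> powr (- s)\<close>. Its height is \<open>\<eta>\<close> and its support
  \<open>{-\<eta>..\<eta>}\<close>, so a pair loses at most \<open>\<epsilon>\<^sup>2 * \<eta>\<^sup>2\<close>, and only if one of its points lies in the support.
  The assumption \<open>mass\<close> says, with the factor \<open>\<epsilon>\<^sup>2\<close> removed, that integrating these bounds over all
  pairs leaves a gain larger than the loss. Absence of atoms
  discards the diagonal, where the potential is infinite; finiteness of the straight energy
  allows it to be cancelled.\<close>

lemma tent_lowers_energy:
  fixes \<Omega> :: "real \<Rightarrow> real" and \<mu> :: "real measure"
  assumes \<mu>: "prob_space \<mu>" and sets_\<mu>[measurable_cong]: "sets \<mu> = sets borel"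
    and no_atoms: "\<And>t. emeasure \<mu> {t} = 0"
    and finite: "(\<integral>\<^sup>+ t. (\<integral>\<^sup>+ u. ennreal (\<bar>t - u\<bar> powr (- s) + (t - u)\<^sup>2) \<partial>\<mu>) \<partial>\<mu>) < \<infinity>"
    and mass: "2 * \<eta>\<^sup>2 * measure \<mu> {-\<eta>..\<eta>} < s / 16 * \<eta> powr (- s) * (measure \<mu> {0..\<eta>})\<^sup>2"
    and \<eta>: "0 < \<eta>"
    and cont: "continuous_on UNIV \<Omega>"
    and per: "\<And>\<theta>. \<Omega> (\<theta> + pi) = \<Omega> \<theta>" and one: "\<Omega> (pi / 2) = 1"
    and s: "0 < s" "s < 1"
    and gain: "\<And>r. \<bar>r\<bar> \<le> r0 \<Longrightarrow>
      (1 + r\<^sup>2) powr (- s / 2) * \<Omega> (pi / 2 - arctan r) \<le> 1 - s / 16 * r\<^sup>2"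
    and \<epsilon>: "0 < \<epsilon>" "\<epsilon> \<le> r0" "r0 \<le> 1"
  shows "interaction_energy (anisotropic_potential s \<Omega>) (graph_measure \<mu> (\<lambda>t. \<epsilon> * max 0 (\<eta> - \<bar>t\<bar>)))
    < interaction_energy (anisotropic_potential s \<Omega>) (graph_measure \<mu> (\<lambda>_. 0))"
proof -
  interpret prob_space \<mu> by fact
  define W where "W = anisotropic_potential s \<Omega>"
  define \<phi> where "\<phi> t = max 0 (\<eta> - \<bar>t\<bar>)" for t
  define I J where "I = {-\<eta>..\<eta>}" and "J = {0..\<eta>}"
  define G where "G = s / 16 * \<epsilon>\<^sup>2 * \<eta> powr (- s)"
  have [measurable]: "W \<in> borel_measurable borel"
    unfolding W_def using anisotropic_potential_measurable[of \<Omega>] per cont by blast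
  have [measurable]: "\<phi> \<in> borel_measurable borel" unfolding \<phi>_def by measurable
  have [measurable]: "I \<in> sets borel" "J \<in> sets borel" by (auto simp: I_def J_def)
  have G: "0 \<le> G" using s by (simp add: G_def)

  define A where "A t u = W (vector [\<epsilon> * \<phi> t - \<epsilon> * \<phi> u, t - u])" for t u
  \<comment> \<open>The form \<open>0 - 0\<close> matches \<open>interaction_energy_graph\<close> at \<open>f = 0\<close>.\<close>
  define B where "B t u = W (vector [0 - 0, t - u])" for t u
  have [measurable]: "case_prod A \<in> borel_measurable (borel \<Otimes>\<^sub>M borel)"
      "case_prod B \<in> borel_measurable (borel \<Otimes>\<^sub>M borel)"
    unfolding A_def B_def by measurable
  have le: "A t u + ennreal (G * (indicator J t * indicator J u))
      \<le> B t u + ennreal (\<epsilon>\<^sup>2 * \<eta>\<^sup>2 * (indicator I t + indicator I u))" if tu: "t \<noteq> u" for t u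
  proof -
    have lip: "\<bar>\<phi> t - \<phi> u\<bar> \<le> \<bar>t - u\<bar>" by (auto simp: \<phi>_def)
    have g1: "G * (indicator J t * indicator J u)
        \<le> s / 16 * \<epsilon>\<^sup>2 * ((\<phi> t - \<phi> u)\<^sup>2 * \<bar>t - u\<bar> powr (- s - 2))"
    proof (cases "t \<in> J \<and> u \<in> J")
      case True
      then have "\<phi> t - \<phi> u = u - t" "\<bar>t - u\<bar> \<le> \<eta>" by (auto simp: \<phi>_def J_def)
      then have "\<eta> powr (- s) \<le> (\<phi> t - \<phi> u)\<^sup>2 * \<bar>t - u\<bar> powr (- s - 2)"
        using tu s powr_mono2'[of "- s" "\<bar>t - u\<bar>" \<eta>]
        by (simp add: powr_diff power2_commute)
      then show ?thesis using True s by (auto simp: G_def mult.assoc intro!: mult_left_mono)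
    next
      case False then show ?thesis using s by auto
    qed
    have g2: "\<epsilon>\<^sup>2 * (\<phi> t - \<phi> u)\<^sup>2 \<le> \<epsilon>\<^sup>2 * \<eta>\<^sup>2 * (indicator I t + indicator I u)"
    proof (cases "t \<in> I \<or> u \<in> I")
      case True
      have "\<bar>\<phi> t - \<phi> u\<bar> \<le> \<bar>\<eta>\<bar>" using \<eta> by (auto simp: \<phi>_def)
      then have "(\<phi> t - \<phi> u)\<^sup>2 \<le> \<eta>\<^sup>2 * 1" by (simp add: abs_le_square_iff)
      also have "\<dots> \<le> \<eta>\<^sup>2 * (indicator I t + indicator I u)"
        using True by (intro mult_left_mono) (auto simp: indicator_def)
      finally show ?thesis by (simp add: mult.assoc mult_left_mono)
    next
      case False
      then show ?thesis by (auto simp: \<phi>_def I_def)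
    qed
    have A: "A t u = anisotropic_potential s \<Omega> (vector [\<epsilon> * (\<phi> t - \<phi> u), t - u])"
      by (simp add: A_def W_def algebra_simps)
    have B: "B t u = ennreal (\<bar>t - u\<bar> powr (- s) + (t - u)\<^sup>2)"
      using anisotropic_potential_vertical[of \<Omega> "t - u" s] per one tu by (simp add: B_def W_def)
    have "A t u + ennreal (G * (indicator J t * indicator J u))
        \<le> A t u + ennreal (s / 16 * \<epsilon>\<^sup>2 * ((\<phi> t - \<phi> u)\<^sup>2 * \<bar>t - u\<bar> powr (- s - 2)))"
      by (intro add_left_mono ennreal_leI g1)
    also have "\<dots> \<le> B t u + ennreal (\<epsilon>\<^sup>2 * (\<phi> t - \<phi> u)\<^sup>2)"
      unfolding A B using tu by (intro anisotropic_potential_tilted_le[of \<Omega> s r0] per s gain \<epsilon> lip) auto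
    also have "\<dots> \<le> B t u + ennreal (\<epsilon>\<^sup>2 * \<eta>\<^sup>2 * (indicator I t + indicator I u))"
      by (intro add_left_mono ennreal_leI g2)
    finally show ?thesis .
  qed
  have ne: "AE u in \<mu>. t \<noteq> u" for t
    using no_atoms[of t] by (intro AE_I[of _ _ "{t}"]) (auto simp: sets_\<mu>)

  define EA EB where "EA = (\<integral>\<^sup>+ t. (\<integral>\<^sup>+ u. A t u \<partial>\<mu>) \<partial>\<mu>)" and "EB = (\<integral>\<^sup>+ t. (\<integral>\<^sup>+ u. B t u \<partial>\<mu>) \<partial>\<mu>)"
  have EB: "EB < \<infinity>"
  proof -
    have "(\<integral>\<^sup>+ u. B t u \<partial>\<mu>) = (\<integral>\<^sup>+ u. ennreal (\<bar>t - u\<bar> powr (- s) + (t - u)\<^sup>2) \<partial>\<mu>)" for t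
    proof (rule nn_integral_cong_AE, use ne[of t] in eventually_elim)
      case (elim u)
      then show ?case
        using anisotropic_potential_vertical[of \<Omega> "t - u" s] per one by (simp add: B_def W_def)
    qed
    then show ?thesis using finite by (simp add: EB_def)
  qed
  have "EA + (\<integral>\<^sup>+ t. (\<integral>\<^sup>+ u. ennreal (G * (indicator J t * indicator J u)) \<partial>\<mu>) \<partial>\<mu>)
      = (\<integral>\<^sup>+ t. (\<integral>\<^sup>+ u. A t u + ennreal (G * (indicator J t * indicator J u)) \<partial>\<mu>) \<partial>\<mu>)"
    unfolding EA_def by (subst nn_integral_add[symmetric]) (auto intro!: nn_integral_cong simp: nn_integral_add)
  also have "\<dots> \<le> (\<integral>\<^sup>+ t. (\<integral>\<^sup>+ u. B t u + ennreal (\<epsilon>\<^sup>2 * \<eta>\<^sup>2 * (indicator I t + indicator I u)) \<partial>\<mu>) \<partial>\<mu>)"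
  proof (rule nn_integral_mono, rule nn_integral_mono_AE)
    fix t show "AE u in \<mu>. A t u + ennreal (G * (indicator J t * indicator J u))
      \<le> B t u + ennreal (\<epsilon>\<^sup>2 * \<eta>\<^sup>2 * (indicator I t + indicator I u))"
      using ne[of t] by eventually_elim (rule le)
  qed
  also have "\<dots> = EB + (\<integral>\<^sup>+ t. (\<integral>\<^sup>+ u. ennreal (\<epsilon>\<^sup>2 * \<eta>\<^sup>2 * (indicator I t + indicator I u)) \<partial>\<mu>) \<partial>\<mu>)"
    unfolding EB_def by (subst nn_integral_add[symmetric]) (auto intro!: nn_integral_cong simp: nn_integral_add)
  also have "(\<integral>\<^sup>+ t. (\<integral>\<^sup>+ u. ennreal (\<epsilon>\<^sup>2 * \<eta>\<^sup>2 * (indicator I t + indicator I u)) \<partial>\<mu>) \<partial>\<mu>)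
      = ennreal (\<epsilon>\<^sup>2 * \<eta>\<^sup>2 * (2 * prob I))"
  proof -
    define K where "K = \<epsilon>\<^sup>2 * \<eta>\<^sup>2"
    have K: "0 \<le> K" by (simp add: K_def)
    have split: "ennreal (K * (indicator I t + indicator I u))
        = ennreal K * indicator I t + ennreal K * indicator I u" for t u
      using K by (auto simp: indicator_def ennreal_plus[symmetric] simp del: ennreal_plus)
    have "(\<integral>\<^sup>+ u. ennreal K * indicator I t + ennreal K * indicator I u \<partial>\<mu>)
        = ennreal K * indicator I t + ennreal K * emeasure \<mu> I" for t
      by (subst nn_integral_add) (auto simp: nn_integral_cmult emeasure_space_1)
    moreover have "(\<integral>\<^sup>+ t. ennreal K * indicator I t + ennreal K * emeasure \<mu> I \<partial>\<mu>)
        = ennreal K * emeasure \<mu> I + ennreal K * emeasure \<mu> I"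
      by (subst nn_integral_add) (auto simp: nn_integral_cmult emeasure_space_1)
    moreover have "ennreal K * emeasure \<mu> I + ennreal K * emeasure \<mu> I = ennreal (K * (2 * prob I))"
    proof -
      have "ennreal K * emeasure \<mu> I = ennreal (K * prob I)"
        using K by (simp add: emeasure_eq_measure ennreal_mult')
      moreover have "K * (2 * prob I) = K * prob I + K * prob I" by simp
      ultimately show ?thesis using K by (simp only: ennreal_plus mult_nonneg_nonneg measure_nonneg)
    qed
    ultimately show ?thesis unfolding K_def[symmetric] split by simp
  qed
  also have "(\<integral>\<^sup>+ t. (\<integral>\<^sup>+ u. ennreal (G * (indicator J t * indicator J u)) \<partial>\<mu>) \<partial>\<mu>)
      = ennreal (G * (prob J)\<^sup>2)"
  proof -
    have "(\<integral>\<^sup>+ u. ennreal (G * (indicator J t * indicator J u)) \<partial>\<mu>)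
        = ennreal (G * prob J) * indicator J t" for t
    proof -
      have "(\<integral>\<^sup>+ u. ennreal (G * (indicator J t * indicator J u)) \<partial>\<mu>)
          = (\<integral>\<^sup>+ u. ennreal G * indicator J t * indicator J u \<partial>\<mu>)"
        using G by (intro nn_integral_cong) (auto simp: indicator_def)
      also have "\<dots> = ennreal G * indicator J t * emeasure \<mu> J"
        by (rule nn_integral_cmult_indicator) simp
      finally show ?thesis using G by (simp add: emeasure_eq_measure ennreal_mult' mult_ac)
    qed
    then have "(\<integral>\<^sup>+ t. (\<integral>\<^sup>+ u. ennreal (G * (indicator J t * indicator J u)) \<partial>\<mu>) \<partial>\<mu>)
        = (\<integral>\<^sup>+ t. ennreal (G * prob J) * indicator J t \<partial>\<mu>)"
      by (simp only:)
    also have "\<dots> = ennreal (G * prob J) * emeasure \<mu> J"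
      by (rule nn_integral_cmult_indicator) simp
    also have "\<dots> = ennreal (G * prob J * prob J)"
      using G by (simp only: emeasure_eq_measure ennreal_mult' measure_nonneg mult_nonneg_nonneg)
    finally show ?thesis by (simp only: power2_eq_square mult.assoc)
  qed
  finally have main: "EA + ennreal (G * (prob J)\<^sup>2) \<le> EB + ennreal (\<epsilon>\<^sup>2 * \<eta>\<^sup>2 * (2 * prob I))" .
  have lt: "\<epsilon>\<^sup>2 * \<eta>\<^sup>2 * (2 * prob I) < G * (prob J)\<^sup>2"
    using mult_strict_left_mono[OF mass, of "\<epsilon>\<^sup>2"] \<epsilon> by (simp add: G_def I_def J_def mult_ac)
  have "EA < EB"
  proof (rule ccontr)
    assume "\<not> EA < EB"
    then have "EB + ennreal (G * (prob J)\<^sup>2) \<le> EB + ennreal (\<epsilon>\<^sup>2 * \<eta>\<^sup>2 * (2 * prob I))"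
      using main by (meson add_right_mono not_less order.trans)
    then have "ennreal (G * (prob J)\<^sup>2) \<le> ennreal (\<epsilon>\<^sup>2 * \<eta>\<^sup>2 * (2 * prob I))"
      using EB by (simp add: ennreal_add_left_cancel_le less_top[symmetric] del: ennreal_le_iff)
    then show False using lt by (simp add: ennreal_le_iff)
  qed
  moreover have "interaction_energy W (graph_measure \<mu> (\<lambda>t. \<epsilon> * \<phi> t)) = (1 / 2) * EA"
    unfolding EA_def A_def by (rule interaction_energy_graph[OF \<mu> sets_\<mu>]) measurable
  moreover have "interaction_energy W (graph_measure \<mu> (\<lambda>_. 0)) = (1 / 2) * EB"
    unfolding EB_def B_def by (rule interaction_energy_graph[OF \<mu> sets_\<mu>]) measurable
  moreover have "(1 / 2) * EA < (1 / 2) * EB"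
  proof (intro ennreal_mult_strict_left_mono \<open>EA < EB\<close>)
    have "(1 / 2 :: ennreal) = ennreal (1 / 2)" using divide_ennreal[of 1 2] by simp
    also have "\<dots> < \<top>" by (rule ennreal_less_top)
    finally show "(1 / 2 :: ennreal) < \<top>" .
    show "(0 :: ennreal) < 1 / 2" by (simp add: ennreal_zero_less_divide)
  qed
  ultimately show ?thesis by (simp add: W_def \<phi>_def)
qed

section \<open>Power integrals on the line\<close>

lemma nn_integral_even:
  fixes f :: "real \<Rightarrow> ennreal"
  assumes [measurable]: "f \<in> borel_measurable borel" and even: "\<And>x. f (- x) = f x"
  shows "(\<integral>\<^sup>+ x. f x \<partial>lborel) = 2 * (\<integral>\<^sup>+ x. f x * indicator {0..} x \<partial>lborel)"
proof -
  have "(\<integral>\<^sup>+ x. f x \<partial>lborel) = (\<integral>\<^sup>+ x. f x * indicator {0..} x + f x * indicator {0..} (- x) \<partial>lborel)"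
    by (intro nn_integral_cong_AE AE_I[of _ _ "{0}"]) (auto simp: indicator_def)
  also have "\<dots> = (\<integral>\<^sup>+ x. f x * indicator {0..} x \<partial>lborel)
      + (\<integral>\<^sup>+ x. f x * indicator {0..} (- x) \<partial>lborel)"
    by (intro nn_integral_add) auto
  also have "(\<integral>\<^sup>+ x. f x * indicator {0..} (- x) \<partial>lborel) = (\<integral>\<^sup>+ x. f x * indicator {0..} x \<partial>lborel)"
    by (subst nn_integral_real_affine[of _ "-1" 0]) (auto simp: even)
  finally show ?thesis by (simp add: mult_2)
qed

text \<open>The substitution \<open>t = x\<^sup>2\<close> on the positive half turns this into Euler's Beta integral.\<close>

lemma nn_integral_one_minus_square_powr:
  assumes p: "p > -1"
  shows "(\<integral>\<^sup>+ x. ennreal ((1 - x\<^sup>2) powr p * indicator {-1..1} x) \<partial>lborel)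
    = ennreal (Beta (1 / 2) (p + 1))"
proof -
  define h where "h t = t powr (- (1 / 2)) * (1 - t) powr p" for t :: real
  have [measurable]: "h \<in> borel_measurable borel" unfolding h_def by measurable
  have "(h has_integral Beta (1 / 2) (p + 1)) {0\<^sup>2..1\<^sup>2}"
    using has_integral_Beta_real[of "1 / 2" "p + 1"] p by (simp add: h_def[abs_def])
  moreover have "h t \<ge> 0" for t by (simp add: h_def)
  ultimately have "ennreal (Beta (1 / 2) (p + 1)) = (\<integral>\<^sup>+ t. ennreal (h t * indicator {0\<^sup>2..1\<^sup>2} t) \<partial>lborel)"
    using nn_integral_has_integral_lebesgue[of "{0\<^sup>2..1\<^sup>2}" h "Beta (1 / 2) (p + 1)"] by (simp add: mult.commute)
  also have "\<dots> = (\<integral>\<^sup>+ x. ennreal (h (x\<^sup>2) * (2 * x) * indicator {0..1} x) \<partial>lborel)"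
    by (rule nn_integral_substitution)
      (auto intro!: derivative_eq_intros continuous_intros simp: set_borel_measurable_def)
  also have "\<dots> = (\<integral>\<^sup>+ x. 2 * (ennreal ((1 - x\<^sup>2) powr p * indicator {-1..1} x) * indicator {0..} x) \<partial>lborel)"
  proof (intro nn_integral_cong_AE)
    have "ennreal (h (x\<^sup>2) * (2 * x) * indicator {0..1} x)
      = 2 * (ennreal ((1 - x\<^sup>2) powr p * indicator {-1..1} x) * indicator {0..} x)" if "x \<noteq> 0" for x
    proof (cases "0 < x \<and> x \<le> 1")
      case True
      then have "h (x\<^sup>2) * (2 * x) = 2 * (1 - x\<^sup>2) powr p"
        by (simp add: h_def powr_minus powr_half_sqrt)
      then have "ennreal (h (x\<^sup>2) * (2 * x)) = 2 * ennreal ((1 - x\<^sup>2) powr p)"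
        by (simp only:) (simp add: ennreal_mult')
      then show ?thesis using True by simp
    next
      case False
      then show ?thesis using that by (auto simp: indicator_def)
    qed
    then show "AE x in lborel. ennreal (h (x\<^sup>2) * (2 * x) * indicator {0..1} x)
      = 2 * (ennreal ((1 - x\<^sup>2) powr p * indicator {-1..1} x) * indicator {0..} x)"
      using AE_lborel_singleton[of "0::real"] by (auto elim: eventually_mono)
  qed
  also have "\<dots> = (\<integral>\<^sup>+ x. ennreal ((1 - x\<^sup>2) powr p * indicator {-1..1} x) \<partial>lborel)"
    by (subst nn_integral_even) (auto simp: nn_integral_cmult indicator_def)
  finally show ?thesis ..
qed

lemma nn_integral_riesz_unit:
  assumes "0 < s" "s < 1"
  shows "(\<integral>\<^sup>+ x. ennreal (\<bar>x\<bar> powr (- s) * indicator {-1..1} x) \<partial>lborel) < \<infinity>"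
proof -
  have i: "((\<lambda>x::real. x powr (- s)) has_integral (1 powr (- s + 1) / (- s + 1))) {0..1}"
    using assms by (intro has_integral_powr_from_0) auto
  have "(\<integral>\<^sup>+ x. ennreal (\<bar>x\<bar> powr (- s) * indicator {-1..1} x) \<partial>lborel)
      = 2 * (\<integral>\<^sup>+ x. ennreal (\<bar>x\<bar> powr (- s) * indicator {-1..1} x) * indicator {0..} x \<partial>lborel)"
    by (rule nn_integral_even) (auto simp: indicator_def)
  also have "(\<integral>\<^sup>+ x. ennreal (\<bar>x\<bar> powr (- s) * indicator {-1..1} x) * indicator {0..} x \<partial>lborel)
      = (\<integral>\<^sup>+ x. ennreal (x powr (- s) * indicator {0..1} x) \<partial>lborel)"
    by (intro nn_integral_cong) (auto simp: indicator_def)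
  also have "\<dots> = ennreal (1 powr (- s + 1) / (- s + 1))"
    using nn_integral_has_integral_lebesgue[OF _ i] by (simp add: mult_ac)
  finally show ?thesis by (simp add: ennreal_mult_less_top)
qed

section \<open>The one-dimensional profile\<close>

lemma C1_pos: "0 < s \<Longrightarrow> s < 1 \<Longrightarrow> C1 s > 0"
  unfolding C1_def by (intro divide_pos_pos mult_pos_pos cos_gt_zero) auto

lemma Beta_real_pos: "a > 0 \<Longrightarrow> b > 0 \<Longrightarrow> Beta a b > (0::real)"
  by (simp add: Beta_def Gamma_real_pos)

lemma R1_eq: "R1 s = (C1 s * Beta (1 / 2) ((3 + s) / 2)) powr (- (1 / (s + 2)))"
  by (simp add: R1_def C1_def)

lemma R1_pos: "0 < s \<Longrightarrow> s < 1 \<Longrightarrow> R1 s > 0"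
  using C1_pos[of s] Beta_real_pos[of "1 / 2" "(3 + s) / 2"] by (simp add: R1_eq)

lemma rho1_measurable [measurable]: "rho1 s \<in> borel_measurable borel"
  unfolding rho1_def by measurable

text \<open>Rescaling to \<open>{-1..1}\<close> gives \<open>C\<^sub>1 * R\<^sub>1 powr (s + 2)\<close> times the Beta value, and \<open>R\<^sub>1\<close> is chosen to make
  this product 1. Without unit mass there would be no couplings, and every neighbourhood of
  \<open>rho_1D s\<close> would be empty.\<close>

lemma nn_integral_rho1:
  assumes s: "0 < s" "s < 1"
  shows "(\<integral>\<^sup>+ t. ennreal (rho1 s t) \<partial>lborel) = 1"
proof -
  define p R B where "p = (1 + s) / 2" and "R = R1 s" and "B = Beta (1 / 2) ((3 + s) / 2)"
  have two_p: "2 * p = 1 + s" by (simp add: p_def)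
  note R = R1_pos[OF s, folded R_def]
  have C: "C1 s > 0" and B: "B > 0"
    using C1_pos[OF s] Beta_real_pos[of "1 / 2" "(3 + s) / 2"] s by (auto simp: B_def)
  have scaled: "rho1 s (0 + R * x) = C1 s * R powr (1 + s) * ((1 - x\<^sup>2) powr p * indicator {-1..1} x)" for x
  proof (cases "x \<in> {-1..1}")
    case True
    then have "x\<^sup>2 \<le> 1" by (auto simp: abs_square_le_1)
    then have "rho1 s (R * x) = C1 s * (R\<^sup>2 * (1 - x\<^sup>2)) powr p"
      using R by (simp add: rho1_def R_def[symmetric] p_def power_mult_distrib algebra_simps mult_left_le)
    also have "\<dots> = C1 s * ((R powr 2) powr p * (1 - x\<^sup>2) powr p)"
      using R by (simp add: powr_mult)
    also have "(R powr 2) powr p = R powr (1 + s)"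
      using two_p by (simp add: powr_powr)
    finally show ?thesis using True by simp
  next
    case False
    then have "x\<^sup>2 > 1" using abs_square_le_1[of x] by (auto simp: not_le[symmetric])
    then have "max 0 (R\<^sup>2 - \<bar>R * x\<bar>\<^sup>2) = 0"
      using R by (simp add: power_mult_distrib)
    then show ?thesis using False by (simp add: rho1_def R_def[symmetric])
  qed
  have "(\<integral>\<^sup>+ t. ennreal (rho1 s t) \<partial>lborel) = ennreal R * (\<integral>\<^sup>+ x. ennreal (rho1 s (0 + R * x)) \<partial>lborel)"
    using R by (subst nn_integral_real_affine[of _ R 0]) auto
  also have "(\<integral>\<^sup>+ x. ennreal (rho1 s (0 + R * x)) \<partial>lborel) = ennreal (C1 s * R powr (1 + s)) * ennreal B"
    unfolding scaled using C s nn_integral_one_minus_square_powr[of p]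
    by (simp add: ennreal_mult' nn_integral_cmult p_def B_def add_divide_distrib)
  also have "ennreal R * (ennreal (C1 s * R powr (1 + s)) * ennreal B) = ennreal (C1 s * B * R powr (s + 2))"
    using R C B by (simp add: ennreal_mult'[symmetric] powr_add powr_numeral power2_eq_square mult_ac)
  also have "R powr (s + 2) = inverse (C1 s * B)"
  proof -
    have "R powr (s + 2) = (C1 s * B) powr (- (1 / (s + 2)) * (s + 2))"
      by (simp only: R_def R1_eq B_def[symmetric] powr_powr)
    also have "- (1 / (s + 2)) * (s + 2) = - 1" using s by simp
    finally show ?thesis using C B by (simp add: powr_minus)
  qed
  also have "C1 s * B * inverse (C1 s * B) = 1"
    using C B by (intro right_inverse) (metis less_irrefl mult_pos_pos)
  finally show ?thesis by simp
qed

definition profile_measure :: "real \<Rightarrow> real measure" where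
  "profile_measure s = density lborel (\<lambda>t. ennreal (rho1 s t))"

lemma sets_profile_measure [measurable_cong, simp]: "sets (profile_measure s) = sets borel"
  by (simp add: profile_measure_def)

lemma prob_space_profile: "0 < s \<Longrightarrow> s < 1 \<Longrightarrow> prob_space (profile_measure s)"
  by (auto intro!: prob_spaceI simp: profile_measure_def emeasure_density nn_integral_rho1)

lemma profile_no_atoms: "emeasure (profile_measure s) {t} = 0"
proof -
  have "emeasure (profile_measure s) {t} = (\<integral>\<^sup>+ x. ennreal (rho1 s x) * indicator {t} x \<partial>lborel)"
    by (simp add: profile_measure_def emeasure_density)
  also have "\<dots> = (\<integral>\<^sup>+ x. 0 \<partial>(lborel :: real measure))"
    by (intro nn_integral_cong_AE AE_I[of _ _ "{t}"]) (auto simp: indicator_def)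
  finally show ?thesis by simp
qed

lemma rho1_nonneg: "0 < s \<Longrightarrow> s < 1 \<Longrightarrow> 0 \<le> rho1 s t"
  using C1_pos[of s] by (simp add: rho1_def)

lemma rho1_antimono:
  assumes "0 < s" "s < 1" "\<bar>t\<bar> \<le> \<bar>u\<bar>"
  shows "rho1 s u \<le> rho1 s t"
  unfolding rho1_def using assms C1_pos[of s]
  by (intro mult_left_mono powr_mono2) (auto simp: abs_le_square_iff)

lemma rho1_pos: "0 < s \<Longrightarrow> s < 1 \<Longrightarrow> \<bar>t\<bar> < R1 s \<Longrightarrow> 0 < rho1 s t"
  using C1_pos[of s] R1_pos[of s] abs_square_less_1[of "t / R1 s"]
  by (auto simp: rho1_def power_divide)

lemma rho1_outside: "0 < s \<Longrightarrow> s < 1 \<Longrightarrow> R1 s < \<bar>t\<bar> \<Longrightarrow> rho1 s t = 0"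
  using R1_pos[of s] power_mono[of "R1 s" "\<bar>t\<bar>" 2] by (simp add: rho1_def)

lemma profile_interval_le:
  assumes s: "0 < s" "s < 1" and "0 < \<eta>"
  shows "measure (profile_measure s) {-\<eta>..\<eta>} \<le> rho1 s 0 * (2 * \<eta>)"
proof -
  interpret prob_space "profile_measure s" using s by (rule prob_space_profile)
  have "emeasure (profile_measure s) {-\<eta>..\<eta>} \<le> (\<integral>\<^sup>+ x. ennreal (rho1 s 0) * indicator {-\<eta>..\<eta>} x \<partial>lborel)"
    using rho1_antimono[OF s, of 0]
    by (auto simp: profile_measure_def emeasure_density intro!: nn_integral_mono mult_right_mono ennreal_leI)
  also have "\<dots> = ennreal (rho1 s 0 * (2 * \<eta>))"
    using assms rho1_nonneg[OF s, of 0] by (simp add: nn_integral_cmult ennreal_mult')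
  finally show ?thesis
    using assms rho1_nonneg[OF s, of 0] by (simp add: emeasure_eq_measure)
qed

lemma profile_interval_ge:
  assumes s: "0 < s" "s < 1" and \<eta>: "0 < \<eta>" "\<eta> \<le> R1 s / 2"
  shows "rho1 s (R1 s / 2) * \<eta> \<le> measure (profile_measure s) {0..\<eta>}"
proof -
  interpret prob_space "profile_measure s" using s by (rule prob_space_profile)
  have "ennreal (rho1 s (R1 s / 2) * \<eta>) = (\<integral>\<^sup>+ x. ennreal (rho1 s (R1 s / 2)) * indicator {0..\<eta>} x \<partial>lborel)"
    using \<eta> rho1_nonneg[OF s] by (simp add: nn_integral_cmult ennreal_mult')
  also have "\<dots> \<le> emeasure (profile_measure s) {0..\<eta>}"
    using rho1_antimono[OF s, of _ "R1 s / 2"] \<eta>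
    by (auto simp: profile_measure_def emeasure_density intro!: nn_integral_mono ennreal_leI split: split_indicator)
  finally show ?thesis by (simp add: emeasure_eq_measure)
qed

text \<open>The density lies between two positive constants near \<open>0\<close>, so the masses of both intervals are
  comparable to \<open>\<eta>\<close>. The loss is then of order \<open>\<eta> ^ 3\<close> and the gain of order \<open>\<eta> powr (2 - s)\<close>, which wins
  for small \<open>\<eta>\<close>.\<close>

lemma tent_width_exists:
  assumes s: "0 < s" "s < 1" and \<delta>: "0 < \<delta>"
  shows "\<exists>\<eta>. 0 < \<eta> \<and> \<eta> < \<delta> \<and> 2 * \<eta>\<^sup>2 * measure (profile_measure s) {-\<eta>..\<eta>}
    < s / 16 * \<eta> powr (- s) * (measure (profile_measure s) {0..\<eta>})\<^sup>2"
proof -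
  define M m where "M = rho1 s 0" and "m = rho1 s (R1 s / 2)"
  have m: "0 < m" "0 < M" using s R1_pos[OF s] by (auto simp: m_def M_def intro!: rho1_pos)
  \<comment> \<open>With masses at least \<open>m * \<eta>\<close> and at most \<open>2 * M * \<eta>\<close>, gain exceeds loss once \<open>\<eta> powr (1 + s) < K\<close>.\<close>
  define K where "K = s * m\<^sup>2 / (64 * M)"
  have K: "K > 0" using m s by (simp add: K_def)
  define \<eta> where "\<eta> = min (min (\<delta> / 2) (R1 s / 2)) ((K / 2) powr (1 / (1 + s)))"
  have \<eta>: "0 < \<eta>" "\<eta> < \<delta>" "\<eta> \<le> R1 s / 2" using \<delta> K R1_pos[OF s] by (auto simp: \<eta>_def)
  have "\<eta> powr (1 + s) \<le> ((K / 2) powr (1 / (1 + s))) powr (1 + s)"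
    using \<eta> s by (intro powr_mono2) (auto simp: \<eta>_def)
  also have "\<dots> < K" using K s by (simp add: powr_powr)
  finally have "\<eta> powr (1 + s) < K" .
  then have small: "\<eta> * \<eta> powr s < K" using \<eta> by (simp add: powr_add)
  have "2 * \<eta>\<^sup>2 * measure (profile_measure s) {-\<eta>..\<eta>} \<le> 2 * \<eta>\<^sup>2 * (M * (2 * \<eta>))"
    using profile_interval_le[OF s \<eta>(1)] by (intro mult_left_mono) (auto simp: M_def)
  also have "\<dots> < s / 16 * \<eta> powr (- s) * (m * \<eta>)\<^sup>2"
  proof -
    have "4 * M * (\<eta> * \<eta> powr s) < s / 16 * m\<^sup>2"
      using small m by (simp add: K_def field_simps)
    then have "\<eta>\<^sup>2 * (4 * M * (\<eta> * \<eta> powr s)) < \<eta>\<^sup>2 * (s / 16 * m\<^sup>2)"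
      using \<eta> by (intro mult_strict_left_mono) auto
    then have "2 * \<eta>\<^sup>2 * (M * (2 * \<eta>)) * \<eta> powr s < s / 16 * (m * \<eta>)\<^sup>2"
      by (simp add: power_mult_distrib mult_ac)
    then have "2 * \<eta>\<^sup>2 * (M * (2 * \<eta>)) < s / 16 * (m * \<eta>)\<^sup>2 / \<eta> powr s"
      using \<eta> by (simp only: pos_less_divide_eq powr_gt_zero)
    then show ?thesis by (simp add: powr_minus_divide)
  qed
  also have "\<dots> \<le> s / 16 * \<eta> powr (- s) * (measure (profile_measure s) {0..\<eta>})\<^sup>2"
    using profile_interval_ge[OF s \<eta>(1,3)] s m \<eta> by (intro mult_left_mono power_mono) (auto simp: m_def)
  finally show ?thesis using \<eta> by blast
qed

text \<open>The density is bounded and \<open>\<bar>x\<bar> powr (- s)\<close> is integrable near \<open>0\<close>, so the potential generated by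
  the profile is bounded on its support.\<close>

lemma profile_energy_finite:
  assumes s: "0 < s" "s < 1"
  shows "(\<integral>\<^sup>+ t. (\<integral>\<^sup>+ u. ennreal (\<bar>t - u\<bar> powr (- s) + (t - u)\<^sup>2) \<partial>profile_measure s) \<partial>profile_measure s) < \<infinity>"
proof -
  define \<mu> where "\<mu> = profile_measure s"
  interpret prob_space \<mu> unfolding \<mu>_def using s by (rule prob_space_profile)
  have [measurable_cong]: "sets \<mu> = sets borel" by (simp add: \<mu>_def)
  define R Q where "R = R1 s" and "Q = (\<integral>\<^sup>+ x. ennreal (\<bar>x\<bar> powr (- s) * indicator {-1..1} x) \<partial>lborel)"
  have "\<bar>t\<bar> \<le> R" if "0 < rho1 s t" for t
    using rho1_outside[OF s, of t] that by (cases "R1 s < \<bar>t\<bar>") (auto simp: R_def)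
  then have near: "AE t in \<mu>. \<bar>t\<bar> \<le> R"
    unfolding \<mu>_def profile_measure_def by (subst AE_density) auto
  have inner: "(\<integral>\<^sup>+ u. ennreal (\<bar>t - u\<bar> powr (- s) + (t - u)\<^sup>2) \<partial>\<mu>)
      \<le> ennreal (rho1 s 0) * Q + ennreal (1 + 4 * R\<^sup>2)" if t: "\<bar>t\<bar> \<le> R" for t
  proof -
    have "(\<integral>\<^sup>+ u. ennreal (\<bar>t - u\<bar> powr (- s) + (t - u)\<^sup>2) \<partial>\<mu>)
        \<le> (\<integral>\<^sup>+ u. ennreal (\<bar>t - u\<bar> powr (- s) * indicator {-1..1} (t - u)) + ennreal (1 + 4 * R\<^sup>2) \<partial>\<mu>)"
    proof (rule nn_integral_mono_AE, use near in eventually_elim)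
      case (elim u)
      have "(t - u)\<^sup>2 \<le> (2 * R)\<^sup>2" using t elim by (intro abs_le_square_iff[THEN iffD1]) auto
      moreover have "\<bar>t - u\<bar> powr (- s) \<le> \<bar>t - u\<bar> powr (- s) * indicator {-1..1} (t - u) + 1"
        using powr_mono2'[of "- s" 1 "\<bar>t - u\<bar>"] s by (auto simp: indicator_def)
      ultimately have "\<bar>t - u\<bar> powr (- s) + (t - u)\<^sup>2
          \<le> \<bar>t - u\<bar> powr (- s) * indicator {-1..1} (t - u) + (1 + 4 * R\<^sup>2)"
        by (simp add: power_mult_distrib)
      then show ?case
        by (subst ennreal_plus[symmetric]) (auto intro: ennreal_leI simp del: ennreal_plus)
    qed
    also have "\<dots> = (\<integral>\<^sup>+ u. ennreal (\<bar>t - u\<bar> powr (- s) * indicator {-1..1} (t - u)) \<partial>\<mu>) + ennreal (1 + 4 * R\<^sup>2)"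
      by (subst nn_integral_add) (auto simp: emeasure_space_1)
    also have "(\<integral>\<^sup>+ u. ennreal (\<bar>t - u\<bar> powr (- s) * indicator {-1..1} (t - u)) \<partial>\<mu>)
        \<le> ennreal (rho1 s 0) * (\<integral>\<^sup>+ u. ennreal (\<bar>t - u\<bar> powr (- s) * indicator {-1..1} (t - u)) \<partial>lborel)"
      unfolding \<mu>_def profile_measure_def using rho1_antimono[OF s, of 0]
      by (auto simp: nn_integral_density nn_integral_cmult[symmetric] intro!: nn_integral_mono mult_right_mono ennreal_leI)
    also have "(\<integral>\<^sup>+ u. ennreal (\<bar>t - u\<bar> powr (- s) * indicator {-1..1} (t - u)) \<partial>lborel) = Q"
      unfolding Q_def by (subst nn_integral_real_affine[of _ "-1" t]) auto
    finally show ?thesis by (simp add: add_right_mono)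
  qed
  have "(\<integral>\<^sup>+ t. (\<integral>\<^sup>+ u. ennreal (\<bar>t - u\<bar> powr (- s) + (t - u)\<^sup>2) \<partial>\<mu>) \<partial>\<mu>)
      \<le> (\<integral>\<^sup>+ t. ennreal (rho1 s 0) * Q + ennreal (1 + 4 * R\<^sup>2) \<partial>\<mu>)"
    by (rule nn_integral_mono_AE, use near in eventually_elim) (rule inner)
  also have "\<dots> = ennreal (rho1 s 0) * Q + ennreal (1 + 4 * R\<^sup>2)"
    by (simp add: emeasure_space_1)
  also have "\<dots> < \<infinity>"
    using nn_integral_riesz_unit[OF s] by (simp add: Q_def[symmetric] ennreal_mult_less_top)
  finally show ?thesis by (simp add: \<mu>_def)
qed

section \<open>Instability of the one-dimensional profile\<close>

text \<open>The tent width \<open>\<eta>\<close> is fixed first, by the balance of gain and loss; the amplitude \<open>\<epsilon>\<close> then only has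
  to be small enough for the tilted kernel estimate, because gain and loss are both multiples
  of \<open>\<epsilon>\<^sup>2\<close>.\<close>

lemma rho_1D_not_local_minimizer:
  fixes \<Omega> :: "real \<Rightarrow> real"
  assumes s: "0 < s" "s < 1" and k: "\<kappa> > 2"
    and cont: "continuous_on UNIV \<Omega>"
    and per: "\<And>\<theta>. \<Omega> (\<theta> + pi) = \<Omega> \<theta>" and one: "\<Omega> (pi / 2) = 1"
    and bound: "\<forall>\<^sub>F \<theta> in nhds (pi / 2). \<Omega> \<theta> \<le> 1 + C * \<bar>\<theta> - pi / 2\<bar> powr \<kappa>"
  shows "\<not> winf_local_minimizer (interaction_energy (anisotropic_potential s \<Omega>)) (rho_1D s)"
proof
  define \<mu> where "\<mu> = profile_measure s"
  have rho: "rho_1D s = graph_measure \<mu> (\<lambda>_. 0)"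
    by (simp add: rho_1D_def \<mu>_def profile_measure_def graph_measure_def)
  have prob: "prob_space \<mu>" unfolding \<mu>_def using s by (rule prob_space_profile)
  have sets: "sets \<mu> = sets borel" by (simp add: \<mu>_def)
  assume "winf_local_minimizer (interaction_energy (anisotropic_potential s \<Omega>)) (rho_1D s)"
  then obtain \<delta> where \<delta>: "\<delta> > 0" and min: "\<And>\<rho>'. borel_prob_measure \<rho>' \<Longrightarrow>
      wasserstein_inf (rho_1D s) \<rho>' < ennreal \<delta> \<Longrightarrow>
      interaction_energy (anisotropic_potential s \<Omega>) (rho_1D s)
        \<le> interaction_energy (anisotropic_potential s \<Omega>) \<rho>'"
    unfolding winf_local_minimizer_def by blast
  obtain \<eta> where \<eta>: "0 < \<eta>" "\<eta> < \<delta>" and mass: "2 * \<eta>\<^sup>2 * measure \<mu> {-\<eta>..\<eta>}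
    < s / 16 * \<eta> powr (- s) * (measure \<mu> {0..\<eta>})\<^sup>2"
    using tent_width_exists[OF s \<delta>] by (auto simp: \<mu>_def)
  obtain \<epsilon> where \<epsilon>: "0 < \<epsilon>" "\<epsilon> \<le> 1" and gain: "\<And>r. \<bar>r\<bar> \<le> \<epsilon> \<Longrightarrow>
      (1 + r\<^sup>2) powr (- s / 2) * \<Omega> (pi / 2 - arctan r) \<le> 1 - s / 16 * r\<^sup>2"
    using tilted_kernel_le[OF s k bound] by blast
  define f where "f t = \<epsilon> * max 0 (\<eta> - \<bar>t\<bar>)" for t
  have [measurable]: "f \<in> borel_measurable borel" unfolding f_def by measurable
  have "\<bar>f t\<bar> \<le> 1 * \<eta>" for t
    unfolding f_def abs_mult using \<epsilon> \<eta> by (intro mult_mono) auto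
  then have "wasserstein_inf (rho_1D s) (graph_measure \<mu> f) \<le> ennreal \<eta>"
    unfolding rho by (intro wasserstein_inf_graph_le prob sets) auto
  also have "\<dots> < ennreal \<delta>" using \<eta> by (intro ennreal_lessI) auto
  finally have "interaction_energy (anisotropic_potential s \<Omega>) (rho_1D s)
      \<le> interaction_energy (anisotropic_potential s \<Omega>) (graph_measure \<mu> f)"
    by (intro min borel_prob_measure_graph prob sets) auto
  moreover have "interaction_energy (anisotropic_potential s \<Omega>) (graph_measure \<mu> f)
      < interaction_energy (anisotropic_potential s \<Omega>) (rho_1D s)"
    unfolding rho f_def
    using tent_lowers_energy[OF prob sets _ _ mass \<eta>(1) cont per one s gain \<epsilon>(1) order.refl \<epsilon>(2)]
      profile_no_atoms profile_energy_finite[OF s] by (simp add: \<mu>_def)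
  ultimately show False by simp
qed

lemma smooth_on_circle_continuous: "smooth_on_circle f \<Longrightarrow> continuous_on UNIV f"
  unfolding smooth_on_circle_def by (metis differentiable_imp_continuous_on funpow_0)

theorem theorem5p5:
  fixes s \<kappa> :: real
  assumes "0 < s" and "s < 1" and "\<kappa> > 2"
  shows
    "(\<forall>\<Omega> :: real \<Rightarrow> real.
        smooth_on_circle \<Omega> \<and> (\<forall>\<theta>. \<Omega> \<theta> > 0) \<and> (\<forall>\<theta>. \<Omega> (\<theta> + pi) = \<Omega> \<theta>) \<and> \<Omega> (pi / 2) = 1 \<and>
        (\<exists>C. \<forall>\<^sub>F \<theta> in nhds (pi / 2). \<Omega> \<theta> \<le> 1 + C * \<bar>\<theta> - pi / 2\<bar> powr \<kappa>)
        \<longrightarrow> \<not> winf_local_minimizer (interaction_energy (anisotropic_potential s \<Omega>)) (rho_1D s))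
     \<and>
     (\<forall>\<omega> :: real \<Rightarrow> real.
        smooth_on_circle \<omega> \<and> (\<forall>\<theta>. \<omega> \<theta> \<ge> 0) \<and> (\<exists>\<theta>. \<omega> \<theta> \<noteq> 0) \<and> (\<forall>\<theta>. \<omega> (\<theta> + pi) = \<omega> \<theta>) \<and>
        \<omega> (pi / 2) = 0 \<and>
        (\<exists>C. \<forall>\<^sub>F \<theta> in nhds (pi / 2). \<omega> \<theta> \<le> C * \<bar>\<theta> - pi / 2\<bar> powr \<kappa>)
        \<longrightarrow> (\<forall>\<alpha>>0. \<not> winf_local_minimizer
               (interaction_energy (anisotropic_potential s (\<lambda>\<theta>. 1 + \<alpha> * \<omega> \<theta>))) (rho_1D s)))"
proof (intro conjI allI impI; elim conjE exE)
  fix \<Omega> :: "real \<Rightarrow> real" and C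
  assume "smooth_on_circle \<Omega>" "\<forall>\<theta>. \<Omega> (\<theta> + pi) = \<Omega> \<theta>" "\<Omega> (pi / 2) = 1"
    "\<forall>\<^sub>F \<theta> in nhds (pi / 2). \<Omega> \<theta> \<le> 1 + C * \<bar>\<theta> - pi / 2\<bar> powr \<kappa>"
  then show "\<not> winf_local_minimizer (interaction_energy (anisotropic_potential s \<Omega>)) (rho_1D s)"
    using assms by (intro rho_1D_not_local_minimizer[of s \<kappa> \<Omega> C] smooth_on_circle_continuous) auto
next
  fix \<omega> :: "real \<Rightarrow> real" and \<alpha> C :: real
  assume "\<alpha> > 0" "smooth_on_circle \<omega>" and per: "\<forall>\<theta>. \<omega> (\<theta> + pi) = \<omega> \<theta>" "\<omega> (pi / 2) = 0"
    and bound: "\<forall>\<^sub>F \<theta> in nhds (pi / 2). \<omega> \<theta> \<le> C * \<bar>\<theta> - pi / 2\<bar> powr \<kappa>"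
  have "continuous_on UNIV (\<lambda>\<theta>. 1 + \<alpha> * \<omega> \<theta>)"
    using smooth_on_circle_continuous[OF \<open>smooth_on_circle \<omega>\<close>] by (intro continuous_intros)
  moreover have "\<forall>\<^sub>F \<theta> in nhds (pi / 2). 1 + \<alpha> * \<omega> \<theta> \<le> 1 + (\<alpha> * C) * \<bar>\<theta> - pi / 2\<bar> powr \<kappa>"
    using bound by eventually_elim (use \<open>\<alpha> > 0\<close> in \<open>simp add: mult.assoc\<close>)
  ultimately show "\<not> winf_local_minimizer
      (interaction_energy (anisotropic_potential s (\<lambda>\<theta>. 1 + \<alpha> * \<omega> \<theta>))) (rho_1D s)"
    using assms per by (intro rho_1D_not_local_minimizer[of s \<kappa> _ "\<alpha> * C"]) auto
qed

end
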